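(* Any derived set of a uniformly recurrent tree set is a uniformly recurrent tree set. That is: let $S\subset A^*$ be a uniformly recurrent tree set, let $w\in S$, and let $f:B^*\to A^*$ be a coding morphism for the set $\mathcal{R}_S(w)$ of first right return words to $w$. Then the derived set $D_f(S)=f^{-1}(w^{-1}S)\subset B^*$ is a uniformly recurrent tree set.
   Context: Words and sets. $A$ is a finite nonempty alphabet, $A^*$ the free monoid of finite words over $A$, $A^+$ the set of nonempty words. A set $S$ of words is factorial if it contains all factors of its elements. A factorial set $S$ is right-extendable if for every $w\in S$ there is a letter $a$ with $wa\in S$, and biextendable if for every $w\in S$ there are letters $a,b$ with $awb\in S$. A set $S$ is uniformly recurrent if it is (nonempty) factorial and right-extendable and for every $u\in S$ there is $n\ge 1$ such that $u$ is a factor of every word of $S$ of length $n$. For a word $w$, $w^{-1}S=\{y\in A^*\mid wy\in S\}$. Tree sets. For a factorial set $S$ and $w\in S$, let $L(w)=\{a\in A\mid aw\in S\}$, $R(w)=\{a\in A\mid wa\in S\}$, $E(w)=\{(a,b)\in A\times A\mid awb\in S\}$. The extension graph $G(w)$ is the undirected graph whose vertex set is the disjoint union of $L(w)$ and $R(w)$ and whose edges are the pairs $(a,b)\in E(w)$ (joining $a\in L(w)$ to $b\in R(w)$). $S$ is a tree set if it is factorial, biextendable, and for every $w\in S$ (including the empty word) the graph $G(w)$ is a tree, i.e. connected and acyclic. Return words. For $w\in S$, $\Gamma_S(w)=\{x\in S\mid wx\in S\cap A^+w\}$ is the set of right return words to $w$, and $\mathcal{R}_S(w)=\Gamma_S(w)\setminus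 \Gamma_S(w)A^+$ is the set of first right return words to $w$ (it is a prefix code). A coding morphism for a code $X\subset A^+$ is a monoid morphism $f:B^*\to A^*$ which maps the alphabet $B$ bijectively onto $X$. *)

theory Defs
  imports "HOL-Library.Sublist" "Graph_Theory.Digraph_Component"
begin

text \<open>
  Words over an alphabet \<open>A :: 'a set\<close> are the elements of \<^term>\<open>lists A\<close>, and "factor" is
  \<^const>\<open>sublist\<close> (contiguous sublist). The alphabet is an explicit parameter because the
  alphabet of a derived set depends on the given set.
\<close>

definition nonempty_words :: "'a set \<Rightarrow> 'a list set" where
  "nonempty_words A = lists A - {[]}"

definition factorial :: "'a list set \<Rightarrow> bool" where
  "factorial S \<longleftrightarrow> (\<forall>u \<in> S. \<forall>v. sublist v u \<longrightarrow> v \<in> S)"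

definition right_extendable :: "'a set \<Rightarrow> 'a list set \<Rightarrow> bool" where
  "right_extendable A S \<longleftrightarrow> (\<forall>w \<in> S. \<exists>a \<in> A. w @ [a] \<in> S)"

definition biextendable :: "'a set \<Rightarrow> 'a list set \<Rightarrow> bool" where
  "biextendable A S \<longleftrightarrow> (\<forall>w \<in> S. \<exists>a \<in> A. \<exists>b \<in> A. [a] @ w @ [b] \<in> S)"

definition uniformly_recurrent :: "'a set \<Rightarrow> 'a list set \<Rightarrow> bool" where
  "uniformly_recurrent A S \<longleftrightarrow>
     S \<noteq> {} \<and> factorial S \<and> right_extendable A S \<and>
     (\<forall>u \<in> S. \<exists>n \<ge> 1. \<forall>v \<in> S. length v = n \<longrightarrow> sublist u v)"

definition left_ext :: "'a set \<Rightarrow> 'a list set \<Rightarrow> 'a list \<Rightarrow> 'a set" where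
  "left_ext A S w = {a \<in> A. [a] @ w \<in> S}"

definition right_ext :: "'a set \<Rightarrow> 'a list set \<Rightarrow> 'a list \<Rightarrow> 'a set" where
  "right_ext A S w = {a \<in> A. w @ [a] \<in> S}"

definition both_ext :: "'a set \<Rightarrow> 'a list set \<Rightarrow> 'a list \<Rightarrow> ('a \<times> 'a) set" where
  "both_ext A S w = {(a, b) \<in> A \<times> A. [a] @ w @ [b] \<in> S}"

text \<open>
  An undirected graph is represented as a symmetric digraph: each edge \<open>(a, b)\<close> of the extension
  graph gives the two arcs between the left vertex \<open>Inl a\<close> and the right vertex \<open>Inr b\<close>.
\<close>

definition extension_graph :: "'a set \<Rightarrow> 'a list set \<Rightarrow> 'a list \<Rightarrow> ('a + 'a) pair_pre_digraph" where
  "extension_graph A S w =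
     \<lparr> pverts = Inl ` left_ext A S w \<union> Inr ` right_ext A S w,
       parcs = (\<Union>(a, b) \<in> both_ext A S w. {(Inl a, Inr b), (Inr b, Inl a)}) \<rparr>"

text \<open>
  The library predicates \<^const>\<open>forest\<close> and \<^const>\<open>tree\<close> are about directed cycles: in a symmetric
  digraph, traversing an edge back and forth is a directed cycle of length 2, so they would exclude
  every edge. In a symmetric digraph without loops and parallel arcs, the cycles of the underlying
  undirected graph are exactly the directed cycles of length at least 3.
\<close>

definition undirected_acyclic :: "'v pair_pre_digraph \<Rightarrow> bool" where
  "undirected_acyclic G \<longleftrightarrow> \<not> (\<exists>p. pre_digraph.cycle (with_proj G) p \<and> length p \<ge> 3)"

definition undirected_tree :: "'v pair_pre_digraph \<Rightarrow> bool" where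
  "undirected_tree G \<longleftrightarrow> connected (with_proj G) \<and> undirected_acyclic G"

definition tree_set :: "'a set \<Rightarrow> 'a list set \<Rightarrow> bool" where
  "tree_set A S \<longleftrightarrow>
     factorial S \<and> biextendable A S \<and> (\<forall>w \<in> S. undirected_tree (extension_graph A S w))"

definition return_words :: "'a set \<Rightarrow> 'a list set \<Rightarrow> 'a list \<Rightarrow> 'a list set" where
  "return_words A S w = {x \<in> S. w @ x \<in> S \<inter> {u @ w |u. u \<in> nonempty_words A}}"

definition first_return_words :: "'a set \<Rightarrow> 'a list set \<Rightarrow> 'a list \<Rightarrow> 'a list set" where
  "first_return_words A S w =
     return_words A S w - {x @ u |x u. x \<in> return_words A S w \<and> u \<in> nonempty_words A}"

definition is_code :: "'a list set \<Rightarrow> bool" where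
  "is_code X \<longleftrightarrow> inj_on concat (lists X)"

definition coding_morphism ::
  "'b set \<Rightarrow> 'a set \<Rightarrow> ('b list \<Rightarrow> 'a list) \<Rightarrow> 'a list set \<Rightarrow> bool" where
  "coding_morphism B A f X \<longleftrightarrow>
     X \<subseteq> nonempty_words A \<and> is_code X \<and>
     (\<forall>u \<in> lists B. f u \<in> lists A) \<and>
     f [] = [] \<and> (\<forall>u \<in> lists B. \<forall>v \<in> lists B. f (u @ v) = f u @ f v) \<and>
     bij_betw (\<lambda>b. f [b]) B X"

definition left_quotient :: "'a set \<Rightarrow> 'a list \<Rightarrow> 'a list set \<Rightarrow> 'a list set" where
  "left_quotient A w S = {y \<in> lists A. w @ y \<in> S}"

definition derived_set ::
  "'b set \<Rightarrow> 'a set \<Rightarrow> ('b list \<Rightarrow> 'a list) \<Rightarrow> 'a list set \<Rightarrow> 'a list \<Rightarrow> 'b list set" where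
  "derived_set B A f S w = {y \<in> lists B. f y \<in> left_quotient A w S}"

text \<open>
  The first return words always form a code, so the code conditions in
  \<^const>\<open>coding_morphism\<close> put no restriction on the set or the word they are taken from.
\<close>

lemma first_return_words_nonempty_words:
  assumes "S \<subseteq> lists A"
  shows "first_return_words A S w \<subseteq> nonempty_words A"
  using assms by (auto simp: first_return_words_def return_words_def nonempty_words_def)

lemma first_return_words_prefix:
  assumes "S \<subseteq> lists A" "x \<in> first_return_words A S w" "y \<in> first_return_words A S w" "prefix x y"
  shows "x = y"
proof (rule ccontr)
  assume "x \<noteq> y"
  then obtain u where u: "y = x @ u" "u \<noteq> []"
    using assms(4) by (auto elim: prefixE)
  have "y \<in> lists A"
    using first_return_words_nonempty_words[OF assms(1)] assms(3) by (auto simp: nonempty_words_def)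
  with u have "u \<in> nonempty_words A"
    by (auto simp: nonempty_words_def)
  with u assms(2,3) show False
    by (auto simp: first_return_words_def)
qed

lemma first_return_words_code:
  assumes "S \<subseteq> lists A"
  shows "is_code (first_return_words A S w)"
proof -
  let ?R = "first_return_words A S w"
  have ne: "x \<noteq> []" if "x \<in> ?R" for x
    using first_return_words_nonempty_words[OF assms] that by (auto simp: nonempty_words_def)
  have "xs = ys" if "xs \<in> lists ?R" "ys \<in> lists ?R" "concat xs = concat ys" for xs ys
    using that
  proof (induction xs arbitrary: ys rule: list.induct)
    case Nil
    then show ?case using ne by (cases ys) auto
  next
    case (Cons x xs)
    then obtain y ys' where ys: "ys = y # ys'"
      using ne by (cases ys) auto
    have "prefix x y \<or> prefix y x"
      using Cons.prems(3) unfolding ys by (metis concat.simps(2) prefixI prefix_same_cases)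
    then have "x = y"
      using first_return_words_prefix[OF assms] Cons.prems ys by (metis Cons_in_lists_iff)
    then show ?case
      using Cons ys by auto
  qed
  then show ?thesis
    by (auto simp: is_code_def inj_on_def)
qed

end

theory Submission
  imports Defs
begin

text \<open>
  For a word \<open>y\<close> of the derived set put \<open>z = w f(y)\<close>. Every first right return word \<open>x\<close> to \<open>w\<close>
  satisfies \<open>w x = x' w\<close> with \<open>x'\<close> a left return word, so the extension graph of \<open>y\<close> is isomorphic to
  the generalized extension graph of \<open>z\<close> whose left vertices are the left return words and whose
  right vertices are the right return words. By uniform recurrence the return words that extend
  \<open>z\<close> on one side are exactly the members extending \<open>z\<close> of a finite complete prefix (or suffix)
  code. All generalized extension graphs for such codes are trees: such a code is
  grown from the empty word by replacing a leaf \<open>q\<close> by its extensions \<open>q a\<close>, and this replaces a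
  vertex of the graph by the tree that the extension graph of \<open>z q\<close> (generalized on the other side)
  spans on its neighbours and the new vertices.
\<close>

section \<open>Undirected trees\<close>

text \<open>
  Acyclicity is expressed by saying that every edge is a bridge. In this form it is a statement about
  reflexive transitive closures, and no paths or cycles have to be manipulated.
\<close>

definition utree :: "'v set \<Rightarrow> ('v \<times> 'v) set \<Rightarrow> bool" where
  "utree V R \<longleftrightarrow> V \<noteq> {} \<and> R \<subseteq> V \<times> V \<and> sym R \<and> (\<forall>x \<in> V. \<forall>y \<in> V. (x, y) \<in> R\<^sup>*) \<and>
     (\<forall>x y. (x, y) \<in> R \<longrightarrow> (x, y) \<notin> (R - {(x, y), (y, x)})\<^sup>*)"

lemma utreeI:
  assumes "V \<noteq> {}" "R \<subseteq> V \<times> V" "sym R" "\<And>x y. x \<in> V \<Longrightarrow> y \<in> V \<Longrightarrow> (x, y) \<in> R\<^sup>*"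
    "\<And>x y. (x, y) \<in> R \<Longrightarrow> (x, y) \<in> (R - {(x, y), (y, x)})\<^sup>* \<Longrightarrow> False"
  shows "utree V R"
  using assms unfolding utree_def by blast

lemma utreeD:
  assumes "utree V R"
  shows "V \<noteq> {}" "R \<subseteq> V \<times> V" "sym R" "\<And>x y. x \<in> V \<Longrightarrow> y \<in> V \<Longrightarrow> (x, y) \<in> R\<^sup>*"
    "\<And>x y. (x, y) \<in> R \<Longrightarrow> (x, y) \<in> (R - {(x, y), (y, x)})\<^sup>* \<Longrightarrow> False"
  using assms unfolding utree_def by blast+

lemma rtrancl_hom:
  assumes "(x, y) \<in> R\<^sup>*" "\<And>a b. (a, b) \<in> R \<Longrightarrow> (\<phi> a, \<phi> b) \<in> R'\<^sup>*"
  shows "(\<phi> x, \<phi> y) \<in> R'\<^sup>*"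
  using assms(1) by induction (use assms(2) rtrancl_trans in \<open>fastforce+\<close>)

lemma rtrancl_closed:
  assumes "(x, y) \<in> R\<^sup>*" "x \<in> C" "\<And>a b. a \<in> C \<Longrightarrow> (a, b) \<in> R \<Longrightarrow> b \<in> C"
  shows "y \<in> C"
  using assms(1,2) by induction (use assms(3) in auto)

lemma utree_image:
  assumes T: "utree V R" and inj: "inj_on \<phi> V"
  shows "utree (\<phi> ` V) (map_prod \<phi> \<phi> ` R)"
proof (rule utreeI)
  note T = utreeD[OF T]
  show "\<phi> ` V \<noteq> {}" "map_prod \<phi> \<phi> ` R \<subseteq> \<phi> ` V \<times> \<phi> ` V"
    using T(1,2) by auto
  show "sym (map_prod \<phi> \<phi> ` R)"
    using T(3) by (force simp: sym_def)
  fix x y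
  {
    assume "x \<in> \<phi> ` V" "y \<in> \<phi> ` V"
    then obtain a b where ab: "a \<in> V" "b \<in> V" "x = \<phi> a" "y = \<phi> b" by auto
    show "(x, y) \<in> (map_prod \<phi> \<phi> ` R)\<^sup>*"
      unfolding ab by (rule rtrancl_hom[OF T(4)[OF ab(1,2)]]) force
  }
  assume "(x, y) \<in> map_prod \<phi> \<phi> ` R"
  then obtain a b where ab: "(a, b) \<in> R" "x = \<phi> a" "y = \<phi> b" by auto
  then have V: "a \<in> V" "b \<in> V" using T(2) by auto
  assume "(x, y) \<in> (map_prod \<phi> \<phi> ` R - {(x, y), (y, x)})\<^sup>*"
  \<comment> \<open>The inverse of \<open>\<phi>\<close> on \<open>V\<close> pulls a detour around
    the image edge back to a detour around \<open>(a, b)\<close>.\<close>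
  then have "(inv_into V \<phi> x, inv_into V \<phi> y) \<in> (R - {(a, b), (b, a)})\<^sup>*"
  proof (rule rtrancl_hom)
    fix u v assume "(u, v) \<in> map_prod \<phi> \<phi> ` R - {(x, y), (y, x)}"
    then obtain c d where cd: "(c, d) \<in> R" "u = \<phi> c" "v = \<phi> d" "(c, d) \<noteq> (a, b)" "(c, d) \<noteq> (b, a)"
      using ab by auto
    moreover then have "c \<in> V" "d \<in> V" using T(2) by auto
    ultimately show "(inv_into V \<phi> u, inv_into V \<phi> v) \<in> (R - {(a, b), (b, a)})\<^sup>*"
      using inj by auto
  qed
  then show False
    using T(5)[OF ab(1)] V ab inj by simp
qed

text \<open>A vertex of \<open>M\<close> has a single edge, so deleting that edge isolates it; hence
  every edge is a bridge.\<close>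

lemma utree_star:
  assumes "c \<notin> M"
  shows "utree (insert c M) ({c} \<times> M \<union> M \<times> {c})"
proof (rule utreeI)
  let ?R = "{c} \<times> M \<union> M \<times> {c}"
  show "sym ?R" by (auto simp: sym_def)
  show "?R \<subseteq> insert c M \<times> insert c M" "insert c M \<noteq> {}" by auto
  fix x y
  {
    assume "x \<in> insert c M" "y \<in> insert c M"
    then have "(x, c) \<in> ?R\<^sup>*" "(c, y) \<in> ?R\<^sup>*" by auto
    then show "(x, y) \<in> ?R\<^sup>*" by (rule rtrancl_trans)
  }
  assume xy: "(x, y) \<in> ?R" and p: "(x, y) \<in> (?R - {(x, y), (y, x)})\<^sup>*"
  show False
  proof (cases "x = c")
    case True
    with xy have "y \<in> M" "y \<noteq> x" using assms by auto
    from rtrancl_closed[OF p, of "- {y}"] this True show False using assms by auto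
  next
    case False
    with xy have "x \<in> M" "y = c" by auto
    from rtrancl_closed[OF p, of "{x}"] this False show False using assms by auto
  qed
qed

text \<open>Removing \<open>l\<close> leaves one component for each neighbour in \<open>N\<close>,
  and the tree \<open>K\<close> joins these components again, touching each in exactly one vertex.
  The bipartite shape of \<open>K\<close> ensures that contracting \<open>M\<close> to
  \<open>l\<close> sends each edge of \<open>K\<close> to an edge of \<open>R\<close> at
  \<open>l\<close>.\<close>

lemma utree_replace:
  assumes T: "utree V R" and l: "l \<in> V" and H: "utree (N \<union> M) K"
    and N: "N = {n. (l, n) \<in> R}" and M: "M \<inter> V = {}" and K: "K \<subseteq> N \<times> M \<union> M \<times> N"
  shows "utree (V - {l} \<union> M) ({(x, y) \<in> R. x \<noteq> l \<and> y \<noteq> l} \<union> K)"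
    (is "utree ?V ?R")
proof (rule utreeI)
  note T = utreeD[OF T] and H = utreeD[OF H]
  have ll: "(l, l) \<notin> R" using T(5) by blast
  have NV: "N \<subseteq> V - {l}" using T(2) N ll by auto
  show "?V \<noteq> {}" using H(1) NV by auto
  show "?R \<subseteq> ?V \<times> ?V" using T(2) K NV by blast
  show sR: "sym ?R" using T(3) H(3) unfolding sym_def by blast
  obtain h where h: "h \<in> N \<union> M" using H(1) by auto
  have hK: "(h, y) \<in> ?R\<^sup>*" if "y \<in> N \<union> M" for y
    using H(4)[OF h that] rtrancl_mono[of K ?R] by auto
  \<comment> \<open>Follow a path of \<open>R\<close> from \<open>l\<close>: whenever it leaves
    \<open>l\<close> it lands in \<open>N\<close>, which \<open>h\<close> reaches inside
    \<open>K\<close>; its edges that avoid \<open>l\<close> survive.\<close>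
  have "y \<noteq> l \<longrightarrow> (h, y) \<in> ?R\<^sup>*" if "(l, y) \<in> R\<^sup>*" for y
    using that
  proof induction
    case (step u v)
    show ?case
    proof (cases "u = l")
      case True
      with step N hK show ?thesis by auto
    next
      case False
      show ?thesis
      proof
        assume "v \<noteq> l"
        with False step have "(u, v) \<in> ?R" by auto
        with False step show "(h, v) \<in> ?R\<^sup>*" by (meson rtrancl.rtrancl_into_rtrancl)
      qed
    qed
  qed simp
  then have hV: "(h, y) \<in> ?R\<^sup>*" if "y \<in> ?V" for y
    using that T(4)[OF l] hK by blast
  fix x y
  {
    assume "x \<in> ?V" "y \<in> ?V"
    then have "(x, h) \<in> ?R\<^sup>*" "(h, y) \<in> ?R\<^sup>*"
      using hV sym_rtrancl[OF sR] symD by fast+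
    then show "(x, y) \<in> ?R\<^sup>*" by (rule rtrancl_trans)
  }
  assume xy: "(x, y) \<in> ?R" and p: "(x, y) \<in> (?R - {(x, y), (y, x)})\<^sup>*"
  show False
  proof (cases "(x, y) \<in> K")
    case False
    with xy have R: "(x, y) \<in> R" "x \<noteq> l" "y \<noteq> l" "x \<notin> M" "y \<notin> M" using M T(2) by auto
    \<comment> \<open>Contracting the inserted vertices back to \<open>l\<close> maps a detour around the edge into the old tree.\<close>
    let ?\<phi> = "\<lambda>v. if v \<in> M then l else v"
    have "(?\<phi> x, ?\<phi> y) \<in> (R - {(x, y), (y, x)})\<^sup>*"
    proof (rule rtrancl_hom[OF p])
      fix a b assume ab: "(a, b) \<in> ?R - {(x, y), (y, x)}"
      show "(?\<phi> a, ?\<phi> b) \<in> (R - {(x, y), (y, x)})\<^sup>*"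
      proof (cases "(a, b) \<in> K")
        case True
        then consider "a \<in> N" "b \<in> M" "a \<notin> M" | "a \<in> M" "b \<in> N" "b \<notin> M" using K M NV by blast
        then show ?thesis
        proof cases
          case 1
          then have "(a, l) \<in> R" using N T(3) by (auto dest: symD)
          with R 1 show ?thesis by auto
        next
          case 2
          then have "(l, b) \<in> R" using N by auto
          with R 2 show ?thesis by auto
        qed
      next
        case False
        with ab have "(a, b) \<in> R" "a \<notin> M" "b \<notin> M" using M T(2) by auto
        with ab show ?thesis by auto
      qed
    qed
    with R T(5) show False by auto
  next
    case xyK: True
    let ?K = "K - {(x, y), (y, x)}" and ?U = "{(x, y) \<in> R. x \<noteq> l \<and> y \<noteq> l}"
    \<comment> \<open>A path from \<open>n\<close> to \<open>n'\<close> avoiding \<open>l\<close>,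
      followed by the edge from \<open>n'\<close> to \<open>l\<close>, would be a detour around the
      edge between \<open>n\<close> and \<open>l\<close>.\<close>
    have uniq: "n = n'" if "n \<in> N" "n' \<in> N" "(n, n') \<in> ?U\<^sup>*" for n n'
    proof (rule ccontr)
      assume "n \<noteq> n'"
      have "(n, n') \<in> (R - {(n, l), (l, n)})\<^sup>*"
        by (rule subsetD[OF rtrancl_mono that(3)]) auto
      moreover have "(n', l) \<in> R"
        using that(2) N T(3) by (simp add: symD)
      then have "(n', l) \<in> R - {(n, l), (l, n)}"
        using \<open>n \<noteq> n'\<close> that(2) NV by blast
      ultimately have "(n, l) \<in> (R - {(n, l), (l, n)})\<^sup>*"
        by (rule rtrancl.rtrancl_into_rtrancl)
      moreover have "(n, l) \<in> R" using that N T(3) by (auto dest: symD)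
      ultimately show False using T(5) by blast
    qed
    \<comment> \<open>The closed set \<open>?C\<close> consists of the part of \<open>K\<close> on the side of \<open>x\<close> and of everything that hangs
      on it; two vertices of \<open>N\<close> are never joined outside \<open>K\<close>, because \<open>R\<close> is acyclic.\<close>
    let ?D = "{v. (x, v) \<in> ?K\<^sup>*}"
    let ?C = "?D \<inter> (N \<union> M) \<union> {v. \<exists>n \<in> N \<inter> ?D. (n, v) \<in> ?U\<^sup>*}"
    have C: "b \<in> ?C" if "a \<in> ?C" "(a, b) \<in> ?R - {(x, y), (y, x)}" for a b
    proof -
      have nM: "v \<notin> M" if "n \<in> N" "(n, v) \<in> ?U\<^sup>*" for n v
        using rtrancl_closed[OF that(2), of "V"] that(1) NV T(2) M by auto
      show ?thesis
      proof (cases "(a, b) \<in> K")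
        case True
        have "a \<in> ?D"
        proof (cases "a \<in> ?D \<inter> (N \<union> M)")
          case False
          then obtain n where n: "n \<in> N \<inter> ?D" "(n, a) \<in> ?U\<^sup>*" using \<open>a \<in> ?C\<close> by auto
          moreover have "a \<in> N" using True K nM n by auto
          ultimately show ?thesis using uniq by auto
        qed auto
        moreover have "(a, b) \<in> ?K" using True that(2) by blast
        ultimately have "(x, b) \<in> ?K\<^sup>*"
          by (simp only: mem_Collect_eq rtrancl.rtrancl_into_rtrancl)
        moreover have "b \<in> N \<union> M" using True K by blast
        ultimately show ?thesis by blast
      next
        case False
        then have ab: "(a, b) \<in> ?U" using that(2) by auto
        then have "a \<notin> M" using M T(2) by auto
        with that(1) obtain n where "n \<in> N \<inter> ?D" "(n, a) \<in> ?U\<^sup>*" by auto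
        with ab show ?thesis by (auto intro: rtrancl.rtrancl_into_rtrancl)
      qed
    qed
    have "x \<in> ?C" using xyK K by auto
    from rtrancl_closed[OF p this C] have y: "y \<in> ?C" .
    \<comment> \<open>Otherwise \<open>y\<close> hangs on some \<open>n\<close> in \<open>N\<close>;
      as an end of an edge of \<open>K\<close> it lies in \<open>N\<close> itself, so it equals
      \<open>n\<close>.\<close>
    have "y \<in> ?D"
    proof (cases "y \<in> ?D \<inter> (N \<union> M)")
      case False
      then obtain n where n: "n \<in> N \<inter> ?D" "(n, y) \<in> ?U\<^sup>*" using y by auto
      have "y \<in> V" using rtrancl_closed[OF n(2), of "V"] n(1) NV T(2) by auto
      then have "y \<in> N" using xyK K M by auto
      then show ?thesis using n uniq by auto
    qed auto
    then show False using H(5)[OF xyK] by auto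
  qed
qed

section \<open>Comparison with reachability, connectedness and cycles in digraphs\<close>

lemma reachable_with_proj_iff:
  assumes sub: "parcs G \<subseteq> pverts G \<times> pverts G" and x: "x \<in> pverts G"
  shows "reachable (with_proj G) x y \<longleftrightarrow> (x, y) \<in> (parcs G)\<^sup>*"
proof
  interpret wf_digraph "with_proj G" by unfold_locales (use sub in auto)
  have ae: "arcs_ends (with_proj G) = parcs G"
    by (auto simp: arcs_ends_def arc_to_ends_def)
  show "(x, y) \<in> (parcs G)\<^sup>*" if "reachable (with_proj G) x y"
    using that unfolding reachable_def ae by (rule rtrancl_on_rtranclI)
  show "reachable (with_proj G) x y" if "(x, y) \<in> (parcs G)\<^sup>*"
    using that
  proof induction
    case base
    show ?case using x by (intro reachable_refl) simp
  next
    case (step u v)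
    then show ?case using reachable_adj_trans ae by blast
  qed
qed

text \<open>\<open>connected\<close> means strong connectedness of the symmetric closure, and a
  symmetric graph is its own symmetric closure.\<close>

lemma connected_with_proj_iff:
  assumes sub: "parcs G \<subseteq> pverts G \<times> pverts G" and sym: "sym (parcs G)"
  shows "connected (with_proj G) \<longleftrightarrow>
    pverts G \<noteq> {} \<and> (\<forall>x \<in> pverts G. \<forall>y \<in> pverts G. (x, y) \<in> (parcs G)\<^sup>*)"
proof -
  have "parcs (mk_symmetric (with_proj G)) = parcs G" "pverts (mk_symmetric (with_proj G)) = pverts G"
    using sym by (auto simp: mk_symmetric_def sym_def)
  then have mk: "mk_symmetric (with_proj G) = G" by simp
  show ?thesis
    unfolding connected_def strongly_connected_def mk
    by (auto simp: reachable_with_proj_iff[OF sub])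
qed

lemma awalk_rtrancl:
  assumes "pre_digraph.awalk (with_proj G) u p v" "set p \<subseteq> R"
  shows "(u, v) \<in> R\<^sup>*"
proof -
  have "pre_digraph.cas (with_proj G) u p v" using assms(1) by (simp add: pre_digraph.awalk_def)
  then show ?thesis using assms(2)
    by (induction p arbitrary: u) (auto simp: pre_digraph.cas.simps intro: converse_rtrancl_into_rtrancl)
qed

text \<open>A detour around an edge closes up with it to a cycle, and a cycle of length at least 3
  minus one arc is a detour around that arc.\<close>

lemma undirected_acyclic_iff:
  assumes sub: "parcs G \<subseteq> pverts G \<times> pverts G" and sym: "sym (parcs G)" and irr: "irrefl (parcs G)"
  shows "undirected_acyclic G \<longleftrightarrow>
    (\<forall>x y. (x, y) \<in> parcs G \<longrightarrow> (x, y) \<notin> (parcs G - {(x, y), (y, x)})\<^sup>*)"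
proof -
  interpret wf_digraph "with_proj G" by unfold_locales (use sub in auto)
  have "\<exists>p. cycle p \<and> length p \<ge> 3"
    if xy: "(x, y) \<in> parcs G" "(x, y) \<in> (parcs G - {(x, y), (y, x)})\<^sup>*" for x y
  proof -
    let ?R = "parcs G - {(x, y), (y, x)}"
    let ?G = "\<lparr>pverts = pverts G, parcs = ?R\<rparr>"
    interpret H: wf_digraph "with_proj ?G" by unfold_locales (use sub in auto)
    have "sym ?R" using sym by (auto simp: sym_def)
    with xy(2) have "(y, x) \<in> ?R\<^sup>*" by (meson sym_rtrancl symD)
    then have "reachable (with_proj ?G) y x"
      using reachable_with_proj_iff[of ?G y x] xy(1) sub by auto
    \<comment> \<open>A detour can be shortened to a simple path, so that closing it with
      \<open>(x, y)\<close> gives a cycle.\<close>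
    then obtain p where p: "H.apath y p x" using H.reachable_apath by auto
    \<comment> \<open>Walks and their vertices depend only on the tails and heads of arcs, which
      agree in both graphs; so \<open>p\<close> is also a path of \<open>G\<close>.\<close>
    have cas: "cas u q v \<longleftrightarrow> H.cas u q v" for u q v
      by (induction q arbitrary: u) auto
    have vts: "awalk_verts u q = H.awalk_verts u q" for u q
      by (induction q arbitrary: u) auto
    have "apath y p x" "set p \<subseteq> ?R"
      using p unfolding apath_def H.apath_def awalk_def H.awalk_def by (auto simp: cas vts)
    then have aw: "awalk y p x" and d: "distinct (awalk_verts y p)" unfolding apath_def by auto
    have "cycle ((x, y) # p)"
      unfolding cycle_def using aw d xy(1) by (auto simp: awalk_Cons_iff intro!: exI[of _ x])
    \<comment> \<open>An empty \<open>p\<close> would make \<open>(x, y)\<close> a loop, and a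
      single arc would have to be the removed \<open>(y, x)\<close>.\<close>
    moreover have "length p \<ge> 2"
    proof (rule ccontr)
      assume "\<not> length p \<ge> 2"
      then consider "p = []" | e where "p = [e]" by (cases p; cases "tl p") auto
      then show False
      proof cases
        case 1
        with aw xy irr show False by (auto simp: awalk_Nil_iff irrefl_def)
      next
        case 2
        with aw \<open>set p \<subseteq> ?R\<close> show False by (cases e) (auto simp: awalk_simps)
      qed
    qed
    ultimately show ?thesis by (intro exI[of _ "(x, y) # p"]) auto
  qed
  moreover have "\<exists>x y. (x, y) \<in> parcs G \<and> (x, y) \<in> (parcs G - {(x, y), (y, x)})\<^sup>*"
    if cyc: "cycle c" "length c \<ge> 3" for c
  proof -
    from cyc obtain u where u: "awalk u c u" "distinct (tl (awalk_verts u c))" "c \<noteq> []"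
      by (auto simp: cycle_def)
    then obtain e p where c: "c = e # p" by (cases c) auto
    define v where "v = snd e"
    have e: "e = (u, v)" "e \<in> parcs G" using u c by (auto simp: awalk_Cons_iff v_def)
    have p: "awalk v p u" "distinct (awalk_verts v p)"
      using u c e by (auto simp: awalk_Cons_iff)
    \<comment> \<open>The path \<open>p\<close> ends in \<open>u\<close>, so an arc of
      \<open>p\<close> leaving \<open>u\<close> would make it visit \<open>u\<close> twice.\<close>
    have "(u, v) \<notin> set p"
    proof
      assume "(u, v) \<in> set p"
      then obtain p1 p2 where p12: "p = p1 @ (u, v) # p2" by (auto simp: in_set_conv_decomp)
      with p(1) have "awalk v p1 u" "awalk v p2 u" by (auto simp: awalk_Cons_iff)
      moreover have "awalk_verts v p = awalk_verts v p1 @ awalk_verts v p2"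
        using p(1) p12 by (auto simp: awalk_verts_append)
      ultimately show False using p(2)
        by (metis awalkE' disjoint_iff distinct_append last_in_set awalk_verts_non_Nil awlast_of_awalk)
    qed
    \<comment> \<open>Simplicity would force \<open>p\<close> to be this single arc, and the cycle
      would only go back and forth along one edge.\<close>
    moreover have "(v, u) \<notin> set p"
    proof
      assume "(v, u) \<in> set p"
      then obtain p1 p2 where p12: "p = p1 @ (v, u) # p2" by (auto simp: in_set_conv_decomp)
      with p(1) have aw: "awalk v p1 v" "awalk u p2 u" by (auto simp: awalk_Cons_iff)
      have vs: "awalk_verts v p = awalk_verts v p1 @ awalk_verts u p2"
        using p(1) p12 by (auto simp: awalk_verts_append)
      have "p1 = []" "p2 = []"
        using apath_ends[of v p1 v] apath_ends[of u p2 u] aw p(2) vs by (auto simp: apath_def)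
      then show False using cyc c p12 by simp
    qed
    ultimately have "(v, u) \<in> (parcs G - {(u, v), (v, u)})\<^sup>*"
      using p(1) by (intro awalk_rtrancl[of G v p u]) (auto simp: awalk_def)
    moreover have "(v, u) \<in> parcs G" using e sym by (auto dest: symD)
    ultimately show ?thesis by (intro exI[of _ v] exI[of _ u]) (simp add: insert_commute)
  qed
  ultimately show ?thesis unfolding undirected_acyclic_def by blast
qed

lemma undirected_tree_iff:
  assumes "parcs G \<subseteq> pverts G \<times> pverts G" "sym (parcs G)" "irrefl (parcs G)"
  shows "undirected_tree G \<longleftrightarrow> utree (pverts G) (parcs G)"
  using assms unfolding undirected_tree_def utree_def
    connected_with_proj_iff[OF assms(1,2)] undirected_acyclic_iff[OF assms] by blast

section \<open>Bipartite trees\<close>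

definition edge_arcs :: "('x \<times> 'y) set \<Rightarrow> (('x + 'y) \<times> ('x + 'y)) set" where
  "edge_arcs E = (\<Union>(x, y) \<in> E. {(Inl x, Inr y), (Inr y, Inl x)})"

lemma edge_arcs_iff [simp]:
  "(Inl x, Inr y) \<in> edge_arcs E \<longleftrightarrow> (x, y) \<in> E"
  "(Inr y, Inl x) \<in> edge_arcs E \<longleftrightarrow> (x, y) \<in> E"
  "(Inl x, Inl x') \<notin> edge_arcs E" "(Inr y, Inr y') \<notin> edge_arcs E"
  by (auto simp: edge_arcs_def)

lemma edge_arcs_cases [consumes 1, case_names lr rl]:
  assumes "(u, v) \<in> edge_arcs E"
  obtains x y where "u = Inl x" "v = Inr y" "(x, y) \<in> E" | x y where "u = Inr y" "v = Inl x" "(x, y) \<in> E"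
  using assms unfolding edge_arcs_def by blast

text \<open>The sum type keeps the two sides disjoint even when the same word occurs on
  both.\<close>

definition btree :: "'x set \<Rightarrow> 'y set \<Rightarrow> ('x \<times> 'y) set \<Rightarrow> bool" where
  "btree X Y E \<longleftrightarrow> utree (Inl ` X \<union> Inr ` Y) (edge_arcs E)"

lemma btree_image:
  assumes T: "btree X Y E" and inj: "inj_on g X" "inj_on h Y"
  shows "btree (g ` X) (h ` Y) (map_prod g h ` E)"
proof -
  have "inj_on (map_sum g h) (Inl ` X \<union> Inr ` Y)"
    using inj by (auto intro!: inj_onI dest: inj_onD)
  from utree_image[OF T[unfolded btree_def] this]
  have "utree (Inl ` g ` X \<union> Inr ` h ` Y) (map_prod (map_sum g h) (map_sum g h) ` edge_arcs E)"
    by (simp add: image_Un image_image)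
  also have "map_prod (map_sum g h) (map_sum g h) ` edge_arcs E = edge_arcs (map_prod g h ` E)"
    by (simp add: edge_arcs_def image_UN case_prod_beta)
  finally show ?thesis unfolding btree_def .
qed

lemma btree_swap:
  assumes "btree X Y E"
  shows "btree Y X (E\<inverse>)"
proof -
  let ?s = "case_sum Inr Inl"
  have "inj_on ?s (Inl ` X \<union> Inr ` Y)" by (auto simp: inj_on_def)
  from utree_image[OF assms[unfolded btree_def] this]
  have "utree (Inl ` Y \<union> Inr ` X) (map_prod ?s ?s ` edge_arcs E)"
    by (simp add: image_Un image_image Un_commute)
  also have "map_prod ?s ?s ` edge_arcs E = edge_arcs (E\<inverse>)"
    by (auto simp: edge_arcs_def image_UN)
  finally show ?thesis unfolding btree_def .
qed

lemma btree_star: "btree {c} Y ({c} \<times> Y)"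
proof -
  have "edge_arcs ({c} \<times> Y) = {Inl c} \<times> Inr ` Y \<union> Inr ` Y \<times> {Inl c}"
    by (auto simp: edge_arcs_def)
  then show ?thesis
    unfolding btree_def using utree_star[of "Inl c" "Inr ` Y"] by auto
qed

text \<open>This is \<open>utree_replace\<close> at the right vertex \<open>y\<close>. Left vertices
  are treated later by reversing all words.\<close>

lemma btree_replace:
  assumes T: "btree X Y E" and y: "y \<in> Y"
    and H: "btree {x. (x, y) \<in> E} Z F" and F: "F \<subseteq> {x. (x, y) \<in> E} \<times> Z" and Z: "Z \<inter> Y = {}"
  shows "btree X (Y - {y} \<union> Z) ({(x, y') \<in> E. y' \<noteq> y} \<union> F)"
proof -
  let ?V = "Inl ` X \<union> Inr ` Y" and ?N = "{x. (x, y) \<in> E}"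
  let ?E = "{(u, v) \<in> edge_arcs E. u \<noteq> Inr y \<and> v \<noteq> Inr y} \<union> edge_arcs F"
  have "n \<in> Inl ` ?N \<longleftrightarrow> (Inr y, n) \<in> edge_arcs E" for n
    by (cases n) auto
  then have N: "Inl ` ?N = {n. (Inr y, n) \<in> edge_arcs E}" by blast
  have "utree (?V - {Inr y} \<union> Inr ` Z) ?E"
  proof (rule utree_replace[OF T[unfolded btree_def] _ H[unfolded btree_def] N])
    show "edge_arcs F \<subseteq> Inl ` ?N \<times> Inr ` Z \<union> Inr ` Z \<times> Inl ` ?N"
      using F by (auto simp: edge_arcs_def)
  qed (use y Z in auto)
  also have "?V - {Inr y} \<union> Inr ` Z = Inl ` X \<union> Inr ` (Y - {y} \<union> Z)" by auto
  also have "(u, v) \<in> ?E \<longleftrightarrow> (u, v) \<in> edge_arcs ({(x, y') \<in> E. y' \<noteq> y} \<union> F)" for u v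
    by (cases u; cases v) auto
  then have "?E = edge_arcs ({(x, y') \<in> E. y' \<noteq> y} \<union> F)" by auto
  finally show ?thesis unfolding btree_def .
qed

section \<open>Generalized extension graphs\<close>

lemma factorialD: "factorial S \<Longrightarrow> u @ v @ t \<in> S \<Longrightarrow> v \<in> S"
  by (auto simp: factorial_def)

text \<open>By factoriality the ends of every edge are vertices, and edges join \<open>Inl\<close>
  to \<open>Inr\<close>, so there are no loops and the relational criterion applies.\<close>

lemma undirected_tree_extension_graph_iff:
  assumes "factorial S"
  shows "undirected_tree (extension_graph A S w) \<longleftrightarrow>
    btree (left_ext A S w) (right_ext A S w) (both_ext A S w)"
proof -
  have "[a] @ w \<in> S" "w @ [b] \<in> S" if "[a] @ w @ [b] \<in> S" for a b
    using that factorialD[OF assms, of "[]" "[a] @ w" "[b]"] factorialD[OF assms, of "[a]" "w @ [b]" "[]"]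
    by simp_all
  then have "both_ext A S w \<subseteq> left_ext A S w \<times> right_ext A S w"
    by (auto simp: both_ext_def left_ext_def right_ext_def)
  moreover have G: "extension_graph A S w =
      \<lparr>pverts = Inl ` left_ext A S w \<union> Inr ` right_ext A S w, parcs = edge_arcs (both_ext A S w)\<rparr>"
    by (simp add: extension_graph_def edge_arcs_def)
  ultimately have "parcs (extension_graph A S w) \<subseteq>
      pverts (extension_graph A S w) \<times> pverts (extension_graph A S w)"
    by (auto elim!: edge_arcs_cases)
  moreover have "sym (parcs (extension_graph A S w))" "irrefl (parcs (extension_graph A S w))"
    by (auto simp: G sym_def irrefl_def elim!: edge_arcs_cases)
  ultimately show ?thesis
    by (simp add: undirected_tree_iff btree_def G)
qed

text \<open>
  The generalized extension graph has left vertices \<open>P\<close> and right vertices \<open>Q\<close>. The left words are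
  stored reversed, so that extending a word away from \<open>z\<close> is appending a letter on both sides.
\<close>

definition gen_tree :: "'a list set \<Rightarrow> 'a list set \<Rightarrow> 'a list set \<Rightarrow> 'a list \<Rightarrow> bool" where
  "gen_tree S P Q z \<longleftrightarrow> btree {p \<in> P. rev p @ z \<in> S} {q \<in> Q. z @ q \<in> S}
     {(p, q) \<in> P \<times> Q. rev p @ z @ q \<in> S}"

abbreviation letters :: "'a set \<Rightarrow> 'a list set" where
  "letters A \<equiv> (\<lambda>a. [a]) ` A"

lemma mem_rev_image_iff: "x \<in> rev ` S \<longleftrightarrow> rev x \<in> S"
  by (metis imageE imageI rev_rev_ident)

text \<open>Reversing all words exchanges the two sides, so results on the right side carry over to
  the left.\<close>

lemma gen_tree_rev:
  assumes "gen_tree S P Q z"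
  shows "gen_tree (rev ` S) Q P (rev z)"
proof -
  have "{(p, q) \<in> P \<times> Q. rev p @ z @ q \<in> S}\<inverse> = {(q, p) \<in> Q \<times> P. rev p @ z @ q \<in> S}"
    by auto
  then show ?thesis
    using btree_swap[OF assms[unfolded gen_tree_def]]
    unfolding gen_tree_def mem_rev_image_iff by simp
qed

lemma rev_image_rev_image [simp]: "rev ` rev ` S = S"
  by (simp add: image_image)

lemma gen_tree_rev_iff: "gen_tree (rev ` S) Q P (rev z) \<longleftrightarrow> gen_tree S P Q z"
  using gen_tree_rev[of S P Q z] gen_tree_rev[of "rev ` S" Q P "rev z"] by auto

lemma factorial_rev: "factorial S \<Longrightarrow> factorial (rev ` S)"
  by (auto simp: factorial_def mem_rev_image_iff sublist_rev_left)

text \<open>The empty word is joined to every right vertex. This star is the base case of both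
  inductions in \<open>gen_tree_cut\<close>.\<close>

lemma gen_tree_star:
  assumes "z \<in> S"
  shows "gen_tree S {[]} Q z"
proof -
  have left: "{p \<in> {[]}. rev p @ z \<in> S} = {[]}" using assms by auto
  have edges: "{(p, q) \<in> {[]} \<times> Q. rev p @ z @ q \<in> S} = {[]} \<times> {q \<in> Q. z @ q \<in> S}" by auto
  show ?thesis unfolding gen_tree_def left edges by (rule btree_star)
qed

definition expand :: "'a set \<Rightarrow> 'a list \<Rightarrow> 'a list set \<Rightarrow> 'a list set" where
  "expand A q Q = Q - {q} \<union> (\<lambda>a. q @ [a]) ` A"

text \<open>The left neighbours of \<open>q\<close> in the graph of \<open>z\<close> are exactly the
  left vertices in the graph of \<open>z @ q\<close>. Hence the latter graph, with each letter
  \<open>a\<close> renamed \<open>q @ [a]\<close>, can take the place of the vertex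
  \<open>q\<close>.\<close>

lemma gen_tree_expand:
  assumes S: "factorial S" and T: "gen_tree S P Q z" and q: "q \<in> Q"
    and H: "z @ q \<in> S \<Longrightarrow> gen_tree S P (letters A) (z @ q)" and disj: "(\<lambda>a. q @ [a]) ` A \<inter> Q = {}"
  shows "gen_tree S P (expand A q Q) z"
proof -
  let ?A = "(\<lambda>a. q @ [a]) ` A"
  show ?thesis
  proof (cases "z @ q \<in> S")
    case False
    \<comment> \<open>Neither \<open>q\<close> nor its extensions are vertices here, so the graph
      does not change.\<close>
    have no: "z @ q @ [a] \<notin> S" "rev p @ z @ q @ [a] \<notin> S" "rev p @ z @ q \<notin> S" for a p
      using False factorialD[OF S, of "[]" "z @ q" "[a]"] factorialD[OF S, of "rev p" "z @ q" "[a]"]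
        factorialD[OF S, of "rev p" "z @ q" "[]"] by auto
    have "{q' \<in> expand A q Q. z @ q' \<in> S} = {q' \<in> Q. z @ q' \<in> S}"
      "{(p, q') \<in> P \<times> expand A q Q. rev p @ z @ q' \<in> S} = {(p, q') \<in> P \<times> Q. rev p @ z @ q' \<in> S}"
      using no False by (auto simp: expand_def)
    then show ?thesis using T by (simp add: gen_tree_def)
  next
    case True
    let ?E = "{(p, q) \<in> P \<times> Q. rev p @ z @ q \<in> S}"
    let ?F = "{(p, q') \<in> P \<times> ?A. rev p @ z @ q' \<in> S}"
    let ?Z = "{q' \<in> ?A. z @ q' \<in> S}"
    have pre: "rev p @ z @ q \<in> S" "z @ q @ [a] \<in> S" if "rev p @ z @ q @ [a] \<in> S" for p a
      using that factorialD[OF S, of "[]" "rev p @ z @ q" "[a]"] factorialD[OF S, of "rev p" "z @ q @ [a]" "[]"]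
      by auto
    have "btree (id ` {p \<in> P. rev p @ z @ q \<in> S}) ((@) q ` {a \<in> letters A. (z @ q) @ a \<in> S})
      (map_prod id ((@) q) ` {(p, a) \<in> P \<times> letters A. rev p @ (z @ q) @ a \<in> S})"
      by (rule btree_image[OF H[OF True, unfolded gen_tree_def]]) (auto intro: inj_onI)
    also have "id ` {p \<in> P. rev p @ z @ q \<in> S} = {p. (p, q) \<in> ?E}" using q by auto
    also have "(@) q ` {a \<in> letters A. (z @ q) @ a \<in> S} = ?Z" by auto
    also have "map_prod id ((@) q) ` {(p, a) \<in> P \<times> letters A. rev p @ (z @ q) @ a \<in> S} = ?F"
      by (auto simp: image_def)
    finally have "btree {p. (p, q) \<in> ?E} ?Z ?F" .
    moreover have "q \<in> {q \<in> Q. z @ q \<in> S}" using q True by simp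
    moreover have "?F \<subseteq> {p. (p, q) \<in> ?E} \<times> ?Z" using q pre by auto
    moreover have "?Z \<inter> {q \<in> Q. z @ q \<in> S} = {}" using disj by blast
    ultimately have "btree {p \<in> P. rev p @ z \<in> S} ({q \<in> Q. z @ q \<in> S} - {q} \<union> ?Z)
      ({(x, y') \<in> ?E. y' \<noteq> q} \<union> ?F)"
      by (intro btree_replace[OF T[unfolded gen_tree_def]])
    also have "{q \<in> Q. z @ q \<in> S} - {q} \<union> ?Z = {q' \<in> expand A q Q. z @ q' \<in> S}"
      by (auto simp: expand_def)
    also have "{(x, y') \<in> ?E. y' \<noteq> q} \<union> ?F = {(p, q') \<in> P \<times> expand A q Q. rev p @ z @ q' \<in> S}"
      by (auto simp: expand_def)
    finally show ?thesis unfolding gen_tree_def .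
  qed
qed

text \<open>The finite complete prefix codes, as sets of leaves of finite trees grown from the root.\<close>

inductive cut :: "'a set \<Rightarrow> 'a list set \<Rightarrow> bool" for A where
  cut_Nil: "cut A {[]}"
| cut_expand: "cut A Q \<Longrightarrow> q \<in> Q \<Longrightarrow> (\<lambda>a. q @ [a]) ` A \<inter> Q = {} \<Longrightarrow> cut A (expand A q Q)"

lemma gen_tree_letters:
  assumes S: "tree_set A S" and z: "z \<in> S"
  shows "gen_tree S (letters A) (letters A) z"
proof -
  have "btree (left_ext A S z) (right_ext A S z) (both_ext A S z)"
    using S z undirected_tree_extension_graph_iff[of S A z] by (auto simp: tree_set_def)
  from btree_image[OF this, of "\<lambda>a. [a]" "\<lambda>a. [a]"]
  have "btree ((\<lambda>a. [a]) ` left_ext A S z) ((\<lambda>a. [a]) ` right_ext A S z)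
    (map_prod (\<lambda>a. [a]) (\<lambda>a. [a]) ` both_ext A S z)" by (simp add: inj_on_def)
  also have "(\<lambda>a. [a]) ` left_ext A S z = {p \<in> letters A. rev p @ z \<in> S}"
    by (auto simp: left_ext_def)
  also have "(\<lambda>a. [a]) ` right_ext A S z = {q \<in> letters A. z @ q \<in> S}"
    by (auto simp: right_ext_def)
  also have "map_prod (\<lambda>a. [a]) (\<lambda>a. [a]) ` both_ext A S z =
      {(p, q) \<in> letters A \<times> letters A. rev p @ z @ q \<in> S}"
    by (force simp: both_ext_def)
  finally show ?thesis unfolding gen_tree_def .
qed

text \<open>Two inductions. With letters on the left, \<open>Q\<close> is grown, each step using the
  tree property at \<open>z @ q\<close>. Then \<open>P\<close> is grown for the fixed
  \<open>Q\<close> in the reversed set, each step using the first result at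
  \<open>rev p @ z\<close>.\<close>

lemma gen_tree_cut:
  assumes S: "tree_set A S" and P: "cut A P" and Q: "cut A Q" and z: "z \<in> S"
  shows "gen_tree S P Q z"
proof -
  have fac: "factorial S" using S by (simp add: tree_set_def)
  have letters_cut: "gen_tree S (letters A) Q z" if "z \<in> S" for z
    using Q
  proof induction
    case cut_Nil
    \<comment> \<open>The centre of the star is on the right, so the star lemma is applied to the
      reversed set.\<close>
    have "gen_tree (rev ` S) {[]} (letters A) (rev z)"
      by (rule gen_tree_star) (use that in auto)
    then show ?case by (simp add: gen_tree_rev_iff)
  next
    case (cut_expand Q q)
    show ?case
      by (rule gen_tree_expand[OF fac cut_expand.IH cut_expand.hyps(2) gen_tree_letters[OF S] cut_expand.hyps(3)])
  qed
  have "gen_tree (rev ` S) Q P (rev z)"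
    using P
  proof induction
    case cut_Nil
    show ?case unfolding gen_tree_rev_iff by (rule gen_tree_star[OF z])
  next
    case (cut_expand P p)
    show ?case
    proof (rule gen_tree_expand[OF _ cut_expand.IH cut_expand.hyps(2) _ cut_expand.hyps(3)])
      show "factorial (rev ` S)" by (rule factorial_rev[OF fac])
      assume "rev z @ p \<in> rev ` S"
      then have "rev p @ z \<in> S" by (simp add: mem_rev_image_iff)
      from gen_tree_rev[OF letters_cut[OF this]]
      show "gen_tree (rev ` S) Q (letters A) (rev z @ p)" by simp
    qed
  qed
  then show ?thesis by (simp add: gen_tree_rev_iff)
qed

section \<open>First return words\<close>

text \<open>The part of the condition on return words that does not mention \<open>S\<close>; it can
  serve as a stopping rule for arbitrary words.\<close>

definition returns_to :: "'a list \<Rightarrow> 'a list \<Rightarrow> bool" where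
  "returns_to w x \<longleftrightarrow> x \<noteq> [] \<and> suffix w (w @ x)"

lemma return_words_iff:
  assumes S: "S \<subseteq> lists A" "factorial S"
  shows "x \<in> return_words A S w \<longleftrightarrow> w @ x \<in> S \<and> returns_to w x"
proof
  assume "x \<in> return_words A S w"
  then obtain u where u: "w @ x \<in> S" "w @ x = u @ w" "u \<noteq> []"
    by (auto simp: return_words_def nonempty_words_def)
  then have "x \<noteq> []" by auto
  then show "w @ x \<in> S \<and> returns_to w x"
    using u by (auto simp: returns_to_def suffix_def)
next
  assume x: "w @ x \<in> S \<and> returns_to w x"
  then obtain u where u: "w @ x = u @ w" "x \<noteq> []" by (auto simp: returns_to_def suffix_def)
  have "u \<noteq> []" using u by auto
  moreover have "u @ w \<in> lists A" using x S(1) u(1) by auto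
  ultimately have "u \<in> nonempty_words A" by (simp add: nonempty_words_def)
  moreover have "x \<in> S" using factorialD[OF S(2), of w x "[]"] x by simp
  ultimately show "x \<in> return_words A S w" using x u(1) by (auto simp: return_words_def)
qed

text \<open>If a prefix \<open>x'\<close> of \<open>x\<close> returns to \<open>w\<close>, then
  \<open>w @ x'\<close> is a factor of \<open>w @ x\<close> and so lies in \<open>S\<close>;
  minimality can therefore be tested without \<open>S\<close>.\<close>

lemma first_return_words_iff:
  assumes S: "S \<subseteq> lists A" "factorial S"
  shows "x \<in> first_return_words A S w \<longleftrightarrow>
    w @ x \<in> S \<and> returns_to w x \<and> (\<forall>x'. prefix x' x \<longrightarrow> returns_to w x' \<longrightarrow> x' = x)"
proof -
  have "(\<exists>x' u. x = x' @ u \<and> x' \<in> return_words A S w \<and> u \<in> nonempty_words A) \<longleftrightarrow>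
    (\<exists>x'. prefix x' x \<and> returns_to w x' \<and> x' \<noteq> x)" (is "?L \<longleftrightarrow> ?R") if x: "w @ x \<in> S"
  proof
    assume ?L
    then obtain x' u where "x = x' @ u" "x' \<in> return_words A S w" "u \<noteq> []"
      by (auto simp: nonempty_words_def)
    then show ?R using return_words_iff[OF S] by (intro exI[of _ x']) auto
  next
    assume ?R
    then obtain x' u where xu: "x = x' @ u" "returns_to w x'" "u \<noteq> []" by (auto simp: prefix_def)
    have "w @ x' \<in> S" using factorialD[OF S(2), of "[]" "w @ x'" u] x xu by simp
    moreover have "u \<in> nonempty_words A" using x xu S(1) by (auto simp: nonempty_words_def)
    ultimately show ?L using xu return_words_iff[OF S] by blast
  qed
  moreover have "x \<in> first_return_words A S w \<longleftrightarrow> x \<in> return_words A S w \<and>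
    \<not> (\<exists>x' u. x = x' @ u \<and> x' \<in> return_words A S w \<and> u \<in> nonempty_words A)"
    unfolding first_return_words_def by blast
  ultimately show ?thesis using return_words_iff[OF S] by blast
qed

text \<open>The returning prefixes of \<open>x\<close> correspond to the occurrences of
  \<open>w\<close> in \<open>w @ x\<close> other than the initial one. The second form is symmetric
  under reversal.\<close>

lemma no_inner_return_iff:
  assumes "returns_to w x"
  shows "(\<forall>x'. prefix x' x \<longrightarrow> returns_to w x' \<longrightarrow> x' = x) \<longleftrightarrow>
    (\<forall>s t. w @ x = s @ w @ t \<longrightarrow> s = [] \<or> t = [])" (is "?L \<longleftrightarrow> ?R")
proof
  assume L: ?L
  show ?R
  proof (intro allI impI)
    fix s t assume st: "w @ x = s @ w @ t"
    then have "prefix w (s @ w)"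
      by (metis append_assoc length_append le_add2 prefixI prefix_length_prefix)
    then obtain x' where x': "s @ w = w @ x'" by (auto simp: prefix_def)
    with st have x: "x = x' @ t" by (metis append.assoc same_append_eq)
    show "s = [] \<or> t = []"
    proof (rule disjCI)
      assume "t \<noteq> []"
      then have "prefix x' x" "x' \<noteq> x" using x by auto
      then have "\<not> returns_to w x'" using L by blast
      moreover have "suffix w (w @ x')" using x'[symmetric] by (rule suffixI)
      ultimately have "x' = []" by (simp add: returns_to_def)
      then show "s = []" using x' by simp
    qed
  qed
next
  assume R: ?R
  show ?L
  proof (intro allI impI)
    fix x' assume x': "prefix x' x" "returns_to w x'"
    then obtain s t where st: "x = x' @ t" "w @ x' = s @ w" by (auto simp: returns_to_def prefix_def suffix_def)
    then have "w @ x = s @ w @ t" by (metis append.assoc)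
    with R have "s = [] \<or> t = []" by blast
    moreover have "s \<noteq> []" using x'(2) st(2) by (auto simp: returns_to_def)
    ultimately show "x' = x" using st by simp
  qed
qed

text \<open>Both sides say that the single word \<open>w @ x = y @ w\<close> lies in
  \<open>S\<close>, is longer than \<open>w\<close> and contains \<open>w\<close> only at its two
  ends.\<close>

lemma first_return_words_rev:
  assumes S: "S \<subseteq> lists A" "factorial S" and xy: "w @ x = y @ w"
  shows "rev y \<in> first_return_words A (rev ` S) (rev w) \<longleftrightarrow> x \<in> first_return_words A S w"
proof -
  have S': "rev ` S \<subseteq> lists A" "factorial (rev ` S)"
    using S factorial_rev by auto
  have len: "length x = length y" using arg_cong[OF xy, of length] by simp
  have eq: "rev w @ rev y = rev x @ rev w" using arg_cong[OF xy, of rev] by simp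
  have ret: "returns_to w x \<longleftrightarrow> x \<noteq> []" "returns_to (rev w) (rev y) \<longleftrightarrow> x \<noteq> []"
    using xy eq len by (auto simp: returns_to_def suffix_def)
  have "rev w @ rev y = s @ rev w @ t \<longleftrightarrow> w @ x = rev t @ w @ rev s" for s t
    using xy by (metis rev_append rev_rev_ident append.assoc)
  then have "(\<forall>s t. rev w @ rev y = s @ rev w @ t \<longrightarrow> s = [] \<or> t = []) \<longleftrightarrow>
    (\<forall>s t. w @ x = s @ w @ t \<longrightarrow> s = [] \<or> t = [])"
    by (metis rev_is_Nil_conv rev_rev_ident)
  moreover have "rev w @ rev y \<in> rev ` S \<longleftrightarrow> w @ x \<in> S"
    using xy by (simp add: mem_rev_image_iff)
  ultimately show ?thesis
    unfolding first_return_words_iff[OF S] first_return_words_iff[OF S']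
    using no_inner_return_iff[of w x] no_inner_return_iff[of "rev w" "rev y"] ret by blast
qed

text \<open>For \<open>q = s @ w @ t\<close> the prefix \<open>s @ w\<close> returns to
  \<open>w\<close>. If \<open>w\<close> is empty this prefix could be empty, so \<open>q\<close>
  itself is taken.\<close>

lemma returns_to_prefix_ex:
  assumes "sublist w q" "q \<noteq> []"
  shows "\<exists>x. prefix x q \<and> returns_to w x"
proof (cases "w = []")
  case True
  then show ?thesis using assms by (intro exI[of _ q]) (auto simp: returns_to_def)
next
  case False
  obtain s t where "q = s @ w @ t" using assms by (auto simp: sublist_def)
  then show ?thesis using False
    by (intro exI[of _ "s @ w"]) (auto simp: returns_to_def suffix_def)
qed

text \<open>Extend \<open>z\<close> by \<open>n\<close> letters inside \<open>S\<close>: the added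
  word contains \<open>w\<close>, and its shortest returning prefix is a first return word.\<close>

lemma first_return_extension:
  assumes S: "S \<subseteq> lists A" "factorial S" "right_extendable A S"
    and n: "n \<ge> 1" "\<forall>v \<in> S. length v = n \<longrightarrow> sublist w v"
    and z: "z \<in> S" "suffix w z"
  shows "\<exists>x \<in> first_return_words A S w. z @ x \<in> S"
proof -
  have "\<exists>q. length q = m \<and> z @ q \<in> S" for m
  proof (induction m)
    case (Suc m)
    then obtain q where q: "length q = m" "z @ q \<in> S" by blast
    then obtain a where "(z @ q) @ [a] \<in> S" using S(3) by (auto simp: right_extendable_def)
    with q show ?case by (intro exI[of _ "q @ [a]"]) simp
  qed (use z in simp)
  then obtain q where q: "length q = n" "z @ q \<in> S" by blast
  moreover have "q \<in> S" using factorialD[OF S(2), of z q "[]"] q by simp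
  ultimately have "\<exists>x. prefix x q \<and> returns_to w x"
    using n by (intro returns_to_prefix_ex) auto
  then obtain x where x: "prefix x q" "returns_to w x"
    and min: "\<And>x'. prefix x' q \<Longrightarrow> returns_to w x' \<Longrightarrow> length x \<le> length x'"
    using exists_least_iff[of "\<lambda>k. \<exists>x. prefix x q \<and> returns_to w x \<and> length x = k"]
    by (metis linorder_not_le)
  obtain t where t: "q = x @ t" using x(1) by (auto simp: prefix_def)
  obtain u where u: "z = u @ w" using z(2) by (auto simp: suffix_def)
  have zx: "z @ x \<in> S" using factorialD[OF S(2), of "[]" "z @ x" t] q t by simp
  have wx: "w @ x \<in> S" using factorialD[OF S(2), of u "w @ x" t] q t u by simp
  have "x' = x" if x': "prefix x' x" "returns_to w x'" for x'
  proof -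
    have "prefix x' q" using x'(1) x(1) by (rule prefix_order.trans)
    then have "length x \<le> length x'" using min x'(2) by blast
    then show ?thesis using x'(1) by (auto simp: prefix_def)
  qed
  then have "x \<in> first_return_words A S w"
    unfolding first_return_words_iff[OF S(1,2)] using wx x(2) by blast
  then show ?thesis using zx by blast
qed

section \<open>Return words and finite complete prefix codes\<close>

text \<open>Completeness of the code: a word read from the root either ends on the way to a leaf or
  passes through one. If it ends at the expanded leaf, any letter of the nonempty alphabet supplies
  a new leaf below it.\<close>

lemma cut_cover:
  assumes "cut A Q" "A \<noteq> {}" "u \<in> lists A"
  shows "\<exists>q \<in> Q. prefix q u \<or> prefix u q"
  using assms(1)
proof induction
  case (cut_expand Q q)
  then obtain q' where q': "q' \<in> Q" "prefix q' u \<or> prefix u q'" by blast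
  have sub: "q' \<in> expand A q Q" if "q' \<noteq> q" using that q' by (auto simp: expand_def)
  have new: "q @ [a] \<in> expand A q Q" if "a \<in> A" for a using that by (auto simp: expand_def)
  obtain a where a: "a \<in> A" using assms(2) by auto
  consider "q' \<noteq> q" | "prefix u q" | b r where "u = q @ b # r"
    using q' by (auto simp: prefix_def) (metis append_Nil2 neq_Nil_conv)
  then show ?case
  proof cases
    case 1
    then show ?thesis using sub q' by blast
  next
    case 2
    then have "prefix u (q @ [a])" by simp
    then show ?thesis using new a by blast
  next
    case (3 b r)
    then have "b \<in> A" "prefix (q @ [b]) u" using assms(3) by auto
    then show ?thesis using new by blast
  qed
qed simp

text \<open>The leaves in \<open>D\<close> are expanded one after another; the last hypothesis keeps
  their extensions disjoint from the current leaves.\<close>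

lemma cut_expand_set:
  assumes "cut A Q" "finite D" "D \<subseteq> Q" "\<And>d a. d \<in> D \<Longrightarrow> d @ [a] \<notin> Q"
  shows "cut A (Q - D \<union> (\<Union>d \<in> D. (\<lambda>a. d @ [a]) ` A))"
  using assms(2-4)
proof (induction D)
  case (insert d D)
  let ?Q = "Q - D \<union> (\<Union>d \<in> D. (\<lambda>a. d @ [a]) ` A)"
  have d: "d \<notin> (\<Union>d \<in> D. (\<lambda>a. d @ [a]) ` A)" using insert.prems by auto
  have "cut A ?Q" using insert.IH insert.prems by auto
  moreover have "d \<in> ?Q" using insert by auto
  moreover have "(\<lambda>a. d @ [a]) ` A \<inter> ?Q = {}" using insert by auto
  ultimately have "cut A (expand A d ?Q)" by (rule cut.cut_expand)
  also have "expand A d ?Q = Q - insert d D \<union> (\<Union>d \<in> insert d D. (\<lambda>a. d @ [a]) ` A)"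
    using d by (auto simp: expand_def)
  finally show ?case .
qed (use assms(1) in simp)

text \<open>The tree is grown level by level, and a branch stops as soon as \<open>P\<close> holds,
  at depth \<open>n\<close> at the latest.\<close>

lemma cut_stopping_ex:
  assumes "finite A"
  shows "\<exists>Q. cut A Q \<and> finite Q \<and> (\<forall>q \<in> Q. q \<in> lists A \<and> length q \<le> n \<and> (P q \<or> length q = n) \<and>
    (\<forall>x. strict_prefix x q \<longrightarrow> \<not> P x))"
proof (induction n)
  case 0
  show ?case by (rule exI[of _ "{[]}"]) (auto intro: cut_Nil)
next
  case (Suc n)
  then obtain Q where Q: "cut A Q" "finite Q"
    and QP: "\<And>q. q \<in> Q \<Longrightarrow> q \<in> lists A \<and> length q \<le> n \<and> (P q \<or> length q = n) \<and> (\<forall>x. strict_prefix x q \<longrightarrow> \<not> P x)"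
    by blast
  let ?D = "{q \<in> Q. \<not> P q}"
  let ?Q = "Q - ?D \<union> (\<Union>d \<in> ?D. (\<lambda>a. d @ [a]) ` A)"
  have len: "length d = n" if "d \<in> ?D" for d using QP that by blast
  \<comment> \<open>A leaf without \<open>P\<close> has length \<open>n\<close>, so its extensions
    are longer than every word of \<open>Q\<close>.\<close>
  have "d @ [a] \<notin> Q" if "d \<in> ?D" for d a
    using QP[of "d @ [a]"] len[OF that] by auto
  then have "cut A ?Q" using Q by (intro cut_expand_set) auto
  moreover have "finite ?Q" using Q(2) assms by auto
  moreover have "q \<in> lists A \<and> length q \<le> Suc n \<and> (P q \<or> length q = Suc n) \<and> (\<forall>x. strict_prefix x q \<longrightarrow> \<not> P x)"
    if "q \<in> ?Q" for q
  proof (cases "q \<in> Q - ?D")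
    case True
    then show ?thesis using QP[of q] by auto
  next
    case False
    with that obtain d a where d: "d \<in> ?D" "a \<in> A" "q = d @ [a]" by blast
    have "\<not> P x" if "strict_prefix x q" for x
    proof -
      have "x = d \<or> strict_prefix x d" using that d(3) by (auto simp: strict_prefix_def)
      then show ?thesis using d(1) QP[of d] by blast
    qed
    then show ?thesis using d QP[of d] len[OF d(1)] by auto
  qed
  ultimately show ?case by blast
qed

text \<open>Branches are stopped at the first return to \<open>w\<close> or at depth
  \<open>n\<close>. A leaf that never returns contains no \<open>w\<close>, so by recurrence it
  cannot extend a word \<open>z\<close> inside \<open>S\<close>.\<close>

lemma first_return_words_cut_ex:
  assumes A: "finite A" "A \<noteq> {}" and S: "S \<subseteq> lists A" "factorial S"
    and n: "n \<ge> 1" "\<forall>v \<in> S. length v = n \<longrightarrow> sublist w v"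
  shows "\<exists>Q. cut A Q \<and> (\<forall>z. suffix w z \<longrightarrow>
    {q \<in> Q. z @ q \<in> S} = {x \<in> first_return_words A S w. z @ x \<in> S})"
proof -
  obtain Q where Q: "cut A Q" and QP: "\<And>q. q \<in> Q \<Longrightarrow> (returns_to w q \<or> length q = n)"
    and Qmin: "\<And>q x. q \<in> Q \<Longrightarrow> strict_prefix x q \<Longrightarrow> \<not> returns_to w x"
    using cut_stopping_ex[OF A(1), of n "returns_to w"] by blast
  have sub: "q \<in> first_return_words A S w" if q: "q \<in> Q" "z @ q \<in> S" "suffix w z" for q z
  proof -
    obtain u where z: "z = u @ w" using q(3) by (auto simp: suffix_def)
    have "w @ q \<in> S" using factorialD[OF S(2), of u "w @ q" "[]"] q z by simp
    moreover have "returns_to w q"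
    proof (rule ccontr)
      assume no: "\<not> returns_to w q"
      then have "length q = n" using QP q by blast
      moreover have "q \<in> S" using factorialD[OF S(2), of z q "[]"] q by simp
      ultimately have "\<exists>x. prefix x q \<and> returns_to w x"
        using n by (intro returns_to_prefix_ex) auto
      then show False using no Qmin[OF q(1)] by (auto simp: strict_prefix_def)
    qed
    ultimately show ?thesis
      unfolding first_return_words_iff[OF S] using Qmin[OF q(1)] by (auto simp: strict_prefix_def)
  qed
  have "x \<in> Q" if x: "x \<in> first_return_words A S w" "z @ x \<in> S" "suffix w z" for x z
  proof -
    have "x \<in> lists A" using x(2) S(1) by auto
    \<comment> \<open>Comparability with a leaf gives equality: if \<open>q\<close> is a prefix of
      \<open>x\<close>, both are first return words and these form a prefix code; if
      \<open>x\<close> is a prefix of \<open>q\<close>, the branch has stopped at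
      \<open>x\<close>.\<close>
    then obtain q where q: "q \<in> Q" "prefix q x \<or> prefix x q" using cut_cover[OF Q A(2)] by blast
    have ret: "returns_to w x" using x(1) first_return_words_iff[OF S] by blast
    from q(2) show ?thesis
    proof
      assume qx: "prefix q x"
      then obtain t where "x = q @ t" by (auto simp: prefix_def)
      then have "z @ q \<in> S" using factorialD[OF S(2), of "[]" "z @ q" t] x(2) by simp
      then have "q \<in> first_return_words A S w" using sub q(1) x(3) by blast
      then have "q = x" using first_return_words_prefix[OF S(1) _ x(1) qx] by blast
      then show ?thesis using q by simp
    next
      assume "prefix x q"
      then show ?thesis using Qmin[OF q(1), of x] ret q(1) by (auto simp: strict_prefix_def)
    qed
  qed
  then show ?thesis using Q sub by blast
qed

section \<open>The derived set\<close>

locale return_coding =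
  fixes A :: "'a set" and B :: "'b set"
    and S :: "'a list set" and w :: "'a list" and f :: "'b list \<Rightarrow> 'a list"
  assumes finite_A: "finite A" and A_nonempty: "A \<noteq> {}" and S_lists: "S \<subseteq> lists A"
    and recurrent: "uniformly_recurrent A S" and tree: "tree_set A S"
    and w_in: "w \<in> S" and coding: "coding_morphism B A f (first_return_words A S w)"
begin

abbreviation "X \<equiv> first_return_words A S w"
abbreviation "X' \<equiv> first_return_words A (rev ` S) (rev w)"
abbreviation "D \<equiv> derived_set B A f S w"

lemma fac: "factorial S"
  using tree by (simp add: tree_set_def)

lemma rev_S: "rev ` S \<subseteq> lists A" "factorial (rev ` S)"
  using S_lists fac factorial_rev by auto

lemma f_Nil: "f [] = []"
  and f_append: "u \<in> lists B \<Longrightarrow> v \<in> lists B \<Longrightarrow> f (u @ v) = f u @ f v"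
  and f_lists: "u \<in> lists B \<Longrightarrow> f u \<in> lists A"
  and f_bij: "bij_betw (\<lambda>b. f [b]) B X"
  using coding unfolding coding_morphism_def by blast+

lemma f_Cons: "b \<in> B \<Longrightarrow> v \<in> lists B \<Longrightarrow> f (b # v) = f [b] @ f v"
  using f_append[of "[b]" v] by simp

lemma f_single: "b \<in> B \<Longrightarrow> f [b] \<in> X"
  using f_bij by (rule bij_betwE[rule_format])

lemma f_surj:
  assumes "x \<in> X"
  obtains b where "b \<in> B" "f [b] = x"
proof -
  have "x \<in> (\<lambda>b. f [b]) ` B" unfolding bij_betw_imp_surj_on[OF f_bij] by (rule assms)
  then show thesis using that by (elim imageE) simp
qed

lemma f_single_iff: "b \<in> B \<Longrightarrow> c \<in> B \<Longrightarrow> f [b] = f [c] \<longleftrightarrow> b = c"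
  using bij_betw_imp_inj_on[OF f_bij] by (auto dest: inj_onD)

lemma f_single_returns: "b \<in> B \<Longrightarrow> w @ f [b] \<in> S \<and> returns_to w (f [b])"
  using f_single first_return_words_iff[OF S_lists fac] by blast

lemma f_single_inner:
  assumes "b \<in> B" "w @ f [b] = s @ w @ t"
  shows "s = [] \<or> t = []"
  using f_single[OF assms(1)] assms(2) no_inner_return_iff[of w "f [b]"]
    first_return_words_iff[OF S_lists fac] by blast

lemma mem_derived: "y \<in> D \<longleftrightarrow> y \<in> lists B \<and> w @ f y \<in> S"
  using f_lists by (auto simp: derived_set_def left_quotient_def)

text \<open>
  The conjugates \<open>rev (g b)\<close> with \<open>w @ f [b] = rev (g b) @ w\<close> are the left return words to \<open>w\<close>.
\<close>

definition g :: "'b \<Rightarrow> 'a list" where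
  "g b = rev (take (length (f [b])) (w @ f [b]))"

lemma w_f:
  assumes "b \<in> B"
  shows "w @ f [b] = rev (g b) @ w"
proof -
  obtain u where u: "w @ f [b] = u @ w"
    using f_single_returns[OF assms] by (auto simp: returns_to_def suffix_def)
  moreover have "length u = length (f [b])" using arg_cong[OF u, of length] by simp
  ultimately show ?thesis by (simp add: g_def)
qed

text \<open>By \<open>w_f\<close>, the words \<open>f [b]\<close> and \<open>g b\<close> determine
  each other, and \<open>first_return_words_rev\<close> matches their first return
  conditions.\<close>

lemma g_bij: "bij_betw g B X'"
proof (rule bij_betw_imageI)
  show "inj_on g B"
  proof (rule inj_onI)
    fix b c assume "b \<in> B" "c \<in> B" "g b = g c"
    then have "w @ f [b] = w @ f [c]" by (simp only: w_f)
    then show "b = c" using f_single_iff \<open>b \<in> B\<close> \<open>c \<in> B\<close> by simp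
  qed
  have "g b \<in> X'" if "b \<in> B" for b
    using first_return_words_rev[OF S_lists fac w_f[OF that]] f_single[OF that] by simp
  moreover have "\<exists>b \<in> B. g b = x" if x: "x \<in> X'" for x
  proof -
    obtain u where u: "rev w @ x = u @ rev w"
      using x first_return_words_iff[OF rev_S] by (auto simp: returns_to_def suffix_def)
    have xu: "w @ rev u = rev x @ w" using arg_cong[OF u, of rev] by simp
    then have "rev u \<in> X" using first_return_words_rev[OF S_lists fac xu] x by simp
    then obtain b where b: "b \<in> B" "f [b] = rev u"
      by (rule f_surj)
    then have "rev (g b) @ w = rev x @ w" using w_f[OF b(1)] xu by simp
    then have "g b = x" by simp
    then show ?thesis using b by blast
  qed
  ultimately show "g ` B = X'" by blast
qed

lemma w_f_Cons:
  assumes "b \<in> B" "y \<in> lists B"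
  shows "w @ f (b # y) = rev (g b) @ w @ f y"
  using f_Cons[OF assms] w_f[OF assms(1)] by (metis append.assoc)

lemma suffix_w_f:
  assumes "y \<in> lists B"
  shows "suffix w (w @ f y)"
  using assms
proof induction
  case (Cons b y)
  then show ?case using w_f_Cons[of b y] by (simp add: suffix_appendI)
qed (simp add: f_Nil)

section \<open>Factors and extensions in the derived set\<close>

lemma derived_factorial: "factorial D"
  unfolding factorial_def
proof (intro ballI allI impI)
  fix y v assume y: "y \<in> D" "sublist v y"
  then obtain p s where psv: "y = p @ v @ s" by (auto simp: sublist_def)
  then have l: "p \<in> lists B" "v \<in> lists B" "s \<in> lists B" using y mem_derived by auto
  \<comment> \<open>Since \<open>w @ f p\<close> ends in \<open>w\<close>, the word
    \<open>w @ f v\<close> is a factor of \<open>w @ f y\<close>.\<close>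
  obtain u where u: "w @ f p = u @ w" using suffix_w_f[OF l(1)] by (auto simp: suffix_def)
  have "w @ f y = (w @ f p) @ f v @ f s" using psv l f_append by simp
  then have "u @ (w @ f v) @ f s \<in> S" using y(1) mem_derived u by simp
  then show "v \<in> D" using factorialD[OF fac] l mem_derived by blast
qed

lemma occurs_within:
  assumes "u \<in> S"
  obtains n where "n \<ge> 1" "\<forall>v \<in> S. length v = n \<longrightarrow> sublist u v"
  using recurrent assms unfolding uniformly_recurrent_def by blast

lemma rev_occurs_within:
  assumes "\<forall>v \<in> S. length v = n \<longrightarrow> sublist w v"
  shows "\<forall>v \<in> rev ` S. length v = n \<longrightarrow> sublist (rev w) v"
  using assms by (simp add: sublist_rev)

lemma derived_right_ext:
  assumes "y \<in> D"
  shows "\<exists>b \<in> B. y @ [b] \<in> D"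
proof -
  obtain n where n: "n \<ge> 1" "\<forall>v \<in> S. length v = n \<longrightarrow> sublist w v"
    using occurs_within[OF w_in] by blast
  have y: "y \<in> lists B" "w @ f y \<in> S" using assms mem_derived by auto
  have "right_extendable A S" using recurrent by (simp add: uniformly_recurrent_def)
  from first_return_extension[OF S_lists fac this n y(2) suffix_w_f[OF y(1)]]
  obtain x where x: "x \<in> X" "(w @ f y) @ x \<in> S" by blast
  obtain b where b: "b \<in> B" "f [b] = x"
    using f_surj[OF x(1)] .
  then have "y @ [b] \<in> D" using x y f_append[of y "[b]"] by (simp add: mem_derived)
  then show ?thesis using b by blast
qed

text \<open>The argument for right extensions is applied to the reversed set, and \<open>g\<close>
  turns the return word found there into a letter.\<close>

lemma derived_left_ext:
  assumes "y \<in> D"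
  shows "\<exists>b \<in> B. b # y \<in> D"
proof -
  obtain n where n: "n \<ge> 1" "\<forall>v \<in> S. length v = n \<longrightarrow> sublist w v"
    using occurs_within[OF w_in] by blast
  have y: "y \<in> lists B" "w @ f y \<in> S" using assms mem_derived by auto
  \<comment> \<open>Left extensions in \<open>S\<close> come from biextendability, which is part of
    being a tree set.\<close>
  have "right_extendable A (rev ` S)"
    unfolding right_extendable_def
  proof
    fix v assume "v \<in> rev ` S"
    then obtain a b where ab: "a \<in> A" "[a] @ rev v @ [b] \<in> S"
      using tree unfolding tree_set_def biextendable_def mem_rev_image_iff by blast
    then have "[a] @ rev v \<in> S" using factorialD[OF fac, of "[]" "[a] @ rev v" "[b]"] by simp
    then show "\<exists>a \<in> A. v @ [a] \<in> rev ` S" using ab(1) by (auto simp: mem_rev_image_iff)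
  qed
  from first_return_extension[OF rev_S this n(1) rev_occurs_within[OF n(2)], where z = "rev (w @ f y)"]
  obtain x where x: "x \<in> X'" "rev (w @ f y) @ x \<in> rev ` S"
    using y by (auto simp: suffix_def mem_rev_image_iff)
  then have "x \<in> g ` B" using bij_betw_imp_surj_on[OF g_bij] by simp
  then obtain b where b: "b \<in> B" "g b = x" by (elim imageE) simp
  have "rev (g b) @ w @ f y \<in> S" using x(2) b(2) by (simp add: mem_rev_image_iff)
  then have "w @ f (b # y) \<in> S" using w_f_Cons[OF b(1) y(1)] by simp
  then have "b # y \<in> D" using b(1) y(1) by (simp add: mem_derived)
  then show ?thesis using b(1) by blast
qed

section \<open>Decoding and uniform recurrence\<close>

text \<open>Occurrences of \<open>w\<close> in \<open>w @ f y\<close> end only at boundaries between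
  coded letters, because \<open>w @ f [b]\<close> contains \<open>w\<close> only at its two
  ends.\<close>

lemma decode_occurrence:
  assumes "y \<in> lists B" "w @ f y = s @ w @ t"
  shows "\<exists>y1 y2. y = y1 @ y2 \<and> f y2 = t"
  using assms
proof (induction arbitrary: s)
  case Nil
  have "length (w @ f []) = length (s @ w @ t)" using Nil by simp
  then show ?case using f_Nil by simp
next
  case (Cons b y)
  show ?case
  proof (cases "length s < length (f [b])")
    case True
    \<comment> \<open>The occurrence lies inside \<open>w @ f [b]\<close> and stops before its end,
      so it must be the initial one.\<close>
    then have "length (s @ w) \<le> length (w @ f [b])" by simp
    moreover have eq: "(w @ f [b]) @ f y = (s @ w) @ t" using Cons.prems f_Cons[OF Cons.hyps] by simp
    ultimately have "prefix (s @ w) (w @ f [b])"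
      by (metis prefixI prefix_length_prefix)
    then obtain t' where t': "w @ f [b] = s @ w @ t'" by (auto simp: prefix_def)
    have "length (f [b]) = length s + length t'" using arg_cong[OF t', of length] by simp
    then have "t' \<noteq> []" using True by auto
    then have "s = []" using f_single_inner[OF Cons.hyps(1) t'] by simp
    then have "f (b # y) = t" using Cons.prems by simp
    then show ?thesis by (intro exI[of _ "[]"] exI[of _ "b # y"]) simp
  next
    case False
    \<comment> \<open>The occurrence starts after the first left return word, which can be stripped
      off.\<close>
    have eq: "rev (g b) @ w @ f y = s @ w @ t"
      using Cons.prems w_f_Cons[OF Cons.hyps] by simp
    have "length (rev (g b)) = length (f [b])" using arg_cong[OF w_f[OF Cons.hyps(1)], of length] by simp
    then have "prefix (rev (g b)) s"
      using eq False by (metis linorder_not_less prefixI prefix_length_prefix)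
    then obtain s' where "s = rev (g b) @ s'" by (auto simp: prefix_def)
    then have "w @ f y = s' @ w @ t" using eq by simp
    from Cons.IH[OF this] obtain y1 y2 where "y = y1 @ y2" "f y2 = t" by blast
    then show ?thesis by (intro exI[of _ "b # y1"] exI[of _ y2]) simp
  qed
qed

text \<open>First return words form a prefix code, so decoding from left to right is forced.\<close>

lemma decode_prefix:
  assumes "u \<in> lists B" "y \<in> lists B" "f y = f u @ t"
  shows "prefix u y"
  using assms
proof (induction arbitrary: y)
  case (Cons c u)
  have fc: "f [c] \<noteq> []" using f_single_returns[OF Cons.hyps(1)] by (simp add: returns_to_def)
  have eq: "f y = f [c] @ f u @ t" using Cons.prems f_Cons[OF Cons.hyps] by simp
  then have "y \<noteq> []" using fc f_Nil by auto
  then obtain d y' where y: "y = d # y'" "d \<in> B" "y' \<in> lists B" using Cons.prems(1) by (cases y) auto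
  have eq': "f [d] @ f y' = f [c] @ f u @ t" using eq f_Cons[OF y(2,3)] y(1) by simp
  then have "prefix (f [d]) (f [c]) \<or> prefix (f [c]) (f [d])"
    by (metis prefixI prefix_same_cases)
  then have "f [c] = f [d]"
    using first_return_words_prefix[OF S_lists] f_single y(2) Cons.hyps(1) by metis
  then have "c = d" using f_single_iff y(2) Cons.hyps(1) by simp
  then show ?case using Cons.IH[OF y(3)] eq' y(1) by simp
qed simp

lemma length_f: "y \<in> lists B \<Longrightarrow> length y \<le> length (f y)"
proof (induction rule: lists.induct)
  case (Cons b y)
  have "f [b] \<noteq> []" using f_single_returns[OF Cons.hyps(1)] by (simp add: returns_to_def)
  then have "length (f [b]) \<ge> 1" by (cases "f [b]") auto
  then show ?case using Cons f_Cons[of b y] by simp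
qed simp

text \<open>The bound \<open>n\<close> for \<open>w @ f u\<close> in \<open>S\<close> also serves
  \<open>u\<close>, since coding does not shorten words. An occurrence of \<open>w @ f u\<close> in
  \<open>w @ f v\<close> is located by its initial \<open>w\<close> and then decodes to an
  occurrence of \<open>u\<close>.\<close>

lemma derived_recurrent:
  assumes "u \<in> D"
  shows "\<exists>n \<ge> 1. \<forall>v \<in> D. length v = n \<longrightarrow> sublist u v"
proof -
  have u: "u \<in> lists B" "w @ f u \<in> S" using assms mem_derived by auto
  obtain n where n: "n \<ge> 1" "\<forall>v \<in> S. length v = n \<longrightarrow> sublist (w @ f u) v"
    using occurs_within[OF u(2)] by blast
  have "sublist u v" if v: "v \<in> D" "length v = n" for v
  proof -
    have vl: "v \<in> lists B" "w @ f v \<in> S" using v(1) mem_derived by auto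
    have len: "n \<le> length (w @ f v)" using length_f[OF vl(1)] v(2) by simp
    have "take n (w @ f v) \<in> S"
      using fac vl(2) sublist_take unfolding factorial_def by blast
    then have "sublist (w @ f u) (take n (w @ f v))" using n(2) len by simp
    then have "sublist (w @ f u) (w @ f v)" by (rule sublist_order.order.trans) (rule sublist_take)
    then obtain s t where "w @ f v = s @ w @ f u @ t" by (auto simp: sublist_def)
    from decode_occurrence[OF vl(1) this]
    obtain v1 v2 where v12: "v = v1 @ v2" "f v2 = f u @ t" by blast
    then have "prefix u v2" using decode_prefix[OF u(1)] vl(1) by simp
    then show ?thesis using v12(1) by (auto simp: prefix_def)
  qed
  then show ?thesis using n(1) by blast
qed

section \<open>Extension graphs of the derived set\<close>

lemma derived_extension_tree:
  assumes "y \<in> D"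
  shows "undirected_tree (extension_graph B D y)"
proof -
  obtain n where n: "n \<ge> 1" "\<forall>v \<in> S. length v = n \<longrightarrow> sublist w v"
    using occurs_within[OF w_in] by blast
  let ?z = "w @ f y"
  have y: "y \<in> lists B" "?z \<in> S" using assms mem_derived by auto
  from first_return_words_cut_ex[OF finite_A A_nonempty S_lists fac n]
  obtain Q where Q: "cut A Q" "\<And>z. suffix w z \<Longrightarrow> {q \<in> Q. z @ q \<in> S} = {x \<in> X. z @ x \<in> S}"
    by (elim exE conjE) simp
  have Q': "{q \<in> Q. ?z @ q \<in> S} = {x \<in> X. ?z @ x \<in> S}"
    by (rule Q(2)[OF suffix_w_f[OF y(1)]])
  \<comment> \<open>The left return words, stored reversed, are first right return words of the
    reversed set, so the same lemma supplies \<open>P\<close>.\<close>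
  from first_return_words_cut_ex[OF finite_A A_nonempty rev_S n(1) rev_occurs_within[OF n(2)]]
  obtain P where P: "cut A P" "\<And>z. suffix (rev w) z \<Longrightarrow>
      {p \<in> P. z @ p \<in> rev ` S} = {x \<in> X'. z @ x \<in> rev ` S}"
    by (elim exE conjE) simp
  have "suffix (rev w) (rev ?z)" by (simp add: suffix_def)
  from P(2)[OF this] have P': "{p \<in> P. rev p @ ?z \<in> S} = {x \<in> X'. rev x @ ?z \<in> S}"
    by (simp add: mem_rev_image_iff)
  have left: "b # y \<in> D \<longleftrightarrow> rev (g b) @ ?z \<in> S" if "b \<in> B" for b
    using that y w_f_Cons[of b y] by (simp add: mem_derived)
  have right: "y @ [b] \<in> D \<longleftrightarrow> ?z @ f [b] \<in> S" if "b \<in> B" for b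
    using that y f_append[of y "[b]"] by (simp add: mem_derived)
  have both: "[b] @ y @ [c] \<in> D \<longleftrightarrow> rev (g b) @ ?z @ f [c] \<in> S" if "b \<in> B" "c \<in> B" for b c
    using that y f_append[of y "[c]"] w_f_Cons[of b "y @ [c]"] by (simp add: mem_derived)
  have gB: "X' = g ` B" and fB: "X = (\<lambda>b. f [b]) ` B"
    using bij_betw_imp_surj_on[OF g_bij] bij_betw_imp_surj_on[OF f_bij] by simp_all
  have leftX: "{p \<in> P. rev p @ ?z \<in> S} = g ` left_ext B D y"
    unfolding P' gB by (auto simp: left_ext_def left)
  have rightX: "{q \<in> Q. ?z @ q \<in> S} = (\<lambda>b. f [b]) ` right_ext B D y"
    unfolding Q' fB by (auto simp: right_ext_def right)
  have bothX: "{(p, q) \<in> P \<times> Q. rev p @ ?z @ q \<in> S} = map_prod g (\<lambda>b. f [b]) ` both_ext B D y"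
  proof (rule set_eqI, clarify)
    fix p q
    \<comment> \<open>Both ends of an edge extend \<open>?z\<close> on their own side, and on such
      words \<open>P\<close> agrees with \<open>X'\<close> and \<open>Q\<close> with
      \<open>X\<close>.\<close>
    have fac2: "rev p @ ?z \<in> S" "?z @ q \<in> S" if "rev p @ ?z @ q \<in> S"
      using that factorialD[OF fac, of "[]" "rev p @ ?z" q] factorialD[OF fac, of "rev p" "?z @ q" "[]"]
      by simp_all
    have "p \<in> P \<and> q \<in> Q \<and> rev p @ ?z @ q \<in> S \<longleftrightarrow>
      p \<in> X' \<and> q \<in> X \<and> rev p @ ?z @ q \<in> S"
      using fac2 P' Q' by blast
    also have "\<dots> \<longleftrightarrow> (\<exists>b \<in> B. \<exists>c \<in> B. p = g b \<and> q = f [c] \<and> rev (g b) @ ?z @ f [c] \<in> S)"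
      unfolding gB fB by blast
    also have "\<dots> \<longleftrightarrow> (p, q) \<in> map_prod g (\<lambda>b. f [b]) ` both_ext B D y"
      using both by (auto simp: both_ext_def)
    finally show "(p, q) \<in> {(p, q) \<in> P \<times> Q. rev p @ ?z @ q \<in> S} \<longleftrightarrow>
        (p, q) \<in> map_prod g (\<lambda>b. f [b]) ` both_ext B D y"
      by simp
  qed
  have "btree {p \<in> P. rev p @ ?z \<in> S} {q \<in> Q. ?z @ q \<in> S} {(p, q) \<in> P \<times> Q. rev p @ ?z @ q \<in> S}"
    using gen_tree_cut[OF tree P(1) Q(1) y(2)] by (simp only: gen_tree_def)
  then have T: "btree (g ` left_ext B D y) ((\<lambda>b. f [b]) ` right_ext B D y)
      (map_prod g (\<lambda>b. f [b]) ` both_ext B D y)"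
    unfolding leftX rightX bothX .
  \<comment> \<open>The tree is now carried back to the letters of \<open>B\<close> along the
    inverse bijections.\<close>
  let ?g = "inv_into B g" and ?f = "inv_into B (\<lambda>b. f [b])"
  have gi: "?g (g b) = b" "?f (f [b]) = b" if "b \<in> B" for b
    using that bij_betw_inv_into_left[OF g_bij] bij_betw_inv_into_left[OF f_bij] by auto
  have sub: "left_ext B D y \<subseteq> B" "right_ext B D y \<subseteq> B" "both_ext B D y \<subseteq> B \<times> B"
    by (auto simp: left_ext_def right_ext_def both_ext_def)
  have "btree (?g ` g ` left_ext B D y) (?f ` (\<lambda>b. f [b]) ` right_ext B D y)
      (map_prod ?g ?f ` map_prod g (\<lambda>b. f [b]) ` both_ext B D y)"
    using sub by (intro btree_image[OF T] inj_on_inv_into image_mono) auto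
  also have "?g ` g ` left_ext B D y = left_ext B D y"
    using sub(1) gi(1) by (force simp: image_image)
  also have "?f ` (\<lambda>b. f [b]) ` right_ext B D y = right_ext B D y"
    using sub(2) gi(2) by (force simp: image_image)
  also have "map_prod ?g ?f ` map_prod g (\<lambda>b. f [b]) ` both_ext B D y = both_ext B D y"
    using sub(3) gi by (force simp: image_image)
  finally show ?thesis
    unfolding undirected_tree_extension_graph_iff[OF derived_factorial] .
qed

end

theorem theorem5p13:
  fixes A :: "'a set" and B :: "'b set"
    and S :: "'a list set" and w :: "'a list" and f :: "'b list \<Rightarrow> 'a list"
  assumes "finite A" and "A \<noteq> {}"
    and "S \<subseteq> lists A"
    and "uniformly_recurrent A S" and "tree_set A S"
    and "w \<in> S"
    and "coding_morphism B A f (first_return_words A S w)"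
  shows "derived_set B A f S w \<subseteq> lists B
    \<and> uniformly_recurrent B (derived_set B A f S w)
    \<and> tree_set B (derived_set B A f S w)"
proof -
  interpret return_coding A B S w f
    using assms by unfold_locales
  have "[] \<in> D" using w_in f_Nil by (simp add: mem_derived)
  moreover have "right_extendable B D"
    using derived_right_ext by (simp add: right_extendable_def)
  ultimately have "uniformly_recurrent B D"
    using derived_factorial derived_recurrent unfolding uniformly_recurrent_def by blast
  moreover have "biextendable B D"
    unfolding biextendable_def
  proof
    fix y assume "y \<in> D"
    then obtain b where b: "b \<in> B" "y @ [b] \<in> D" using derived_right_ext by blast
    then obtain a where "a \<in> B" "a # y @ [b] \<in> D" using derived_left_ext by blast
    with b show "\<exists>a \<in> B. \<exists>b \<in> B. [a] @ y @ [b] \<in> D" by auto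
  qed
  then have "tree_set B D"
    using derived_factorial derived_extension_tree by (simp add: tree_set_def)
  moreover have "D \<subseteq> lists B" using mem_derived by blast
  ultimately show ?thesis by blast
qed

end
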